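(* For every integer $n\ge0$ let $$P_n=P_n(q)=\sum_{j\ge0}\sum_{k\ge0}(-1)^kq^{2j^2+2j+k}\begin{bmatrix} 2j+k-1\\ k\end{bmatrix}_{q}\begin{bmatrix} n-j-k\\ j\end{bmatrix}_{q^2}.$$ Then $$P_n=\sum_{j=-\infty}^\infty(-1)^jq^{j(7j+3)/2}\begin{bmatrix} n+1\\ \left\lfloor\frac{2n+7j+5}{4}\right\rfloor\end{bmatrix}_{q^2},$$ and $P_0=P_1=1$, $P_2=q^4+1$, and $P_n=(1-q-q^2)P_{n-1}+(q^{2n}-q^3+q^2+q)P_{n-2}+q^3P_{n-3}$ for $n\ge3$.
   Context: $q$ is an indeterminate. $(a;p)_n=\prod_{i=0}^{n-1}(1-ap^i)$. The Gaussian polynomial in base $p$ is $\begin{bmatrix} A\\ B\end{bmatrix}_{p}=\frac{(p;p)_A}{(p;p)_B(p;p)_{A-B}}$ if $0\le B\le A$, and $0$ otherwise; the only exception is that the factor $\begin{bmatrix} 2j+k-1\\ k\end{bmatrix}_{q}$ is taken to be $1$ when $j=k=0$. All sums have only finitely many nonzero terms. *)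

theory Defs
  imports
    "HOL-Computational_Algebra.Fraction_Field"
    "HOL-Computational_Algebra.Polynomial"
    "HOL-Library.Groups_Big_Fun"
begin

definition qpoch :: "'a::comm_ring_1 \<Rightarrow> 'a \<Rightarrow> nat \<Rightarrow> 'a" where
  "qpoch a p n = (\<Prod>i<n. 1 - a * p ^ i)"

text \<open>The entries are integers, since negative upper and lower entries occur below.\<close>

definition gauss_poly :: "'a::field \<Rightarrow> int \<Rightarrow> int \<Rightarrow> 'a" where
  "gauss_poly p A B =
     (if 0 \<le> B \<and> B \<le> A
      then qpoch p p (nat A) / (qpoch p p (nat B) * qpoch p p (nat (A - B)))
      else 0)"

text \<open>The indeterminate, in the field of fractions of the integer polynomials. Neither it
  nor its square is a root of unity, so the denominators above do not vanish.\<close>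

definition q :: "int poly fract" where
  "q = Fraction_Field.Fract [:0, 1:] 1"

definition first_factor :: "nat \<Rightarrow> nat \<Rightarrow> int poly fract" where
  "first_factor j k =
     (if j = 0 \<and> k = 0 then 1 else gauss_poly q (2 * int j + int k - 1) (int k))"

definition P_summand :: "nat \<Rightarrow> nat \<Rightarrow> nat \<Rightarrow> int poly fract" where
  "P_summand n j k =
     (- 1) ^ k * q ^ (2 * j ^ 2 + 2 * j + k) * first_factor j k *
       gauss_poly (q ^ 2) (int n - int j - int k) (int j)"

text \<open>\<^const>\<open>Sum_any\<close> is the sum over the support of a function, and is 0 if the support is
  infinite; the supports that occur here are finite by the lemmas below.\<close>

definition P :: "nat \<Rightarrow> int poly fract" where
  "P n = Sum_any (\<lambda>j. Sum_any (\<lambda>k. P_summand n j k))"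

lemma P_summand_eq_0:
  assumes "n < 2 * j + k"
  shows "P_summand n j k = 0"
  using assms by (auto simp: P_summand_def gauss_poly_def)

lemma finite_support_P_inner: "finite {k. P_summand n j k \<noteq> 0}"
proof (rule finite_subset[of _ "{..n}"])
  have "P_summand n j k = 0" if "n < k" for k
    using that by (simp add: P_summand_eq_0)
  then show "{k. P_summand n j k \<noteq> 0} \<subseteq> {..n}"
    by (force simp flip: linorder_not_less)
qed simp

lemma finite_support_P_outer: "finite {j. Sum_any (\<lambda>k. P_summand n j k) \<noteq> 0}"
proof (rule finite_subset[of _ "{..n}"])
  have "Sum_any (\<lambda>k. P_summand n j k) = 0" if "n < j" for j
    using that by (simp add: P_summand_eq_0)
  then show "{j. Sum_any (\<lambda>k. P_summand n j k) \<noteq> 0} \<subseteq> {..n}"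
    by (force simp flip: linorder_not_less)
qed simp

text \<open>The two integer divisions in the next lemma: the one in the exponent is exact, with
  non-negative result, and the one in the lower entry rounds towards minus infinity, i.e. is
  the floor of the quotient.\<close>

lemma finite_support_bilateral:
  "finite {j::int. (- 1) powi j * q powi (j * (7 * j + 3) div 2) *
     gauss_poly (q ^ 2) (int n + 1) ((2 * int n + 7 * j + 5) div 4) \<noteq> 0}" (is "finite ?S")
proof (rule finite_subset[of _ "{- int n - 5..int n + 5}"])
  have "gauss_poly (q ^ 2) (int n + 1) ((2 * int n + 7 * j + 5) div 4) = 0"
    if "j < - int n - 5 \<or> int n + 5 < j" for j
  proof -
    have "(2 * int n + 7 * j + 5) div 4 < 0 \<or> int n + 1 < (2 * int n + 7 * j + 5) div 4"
      using that by linarith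
    then show ?thesis by (auto simp: gauss_poly_def)
  qed
  then show "?S \<subseteq> {- int n - 5..int n + 5}"
    by force
qed simp

end

theory Submission
  imports Defs "HOL-Computational_Algebra.Formal_Power_Series"
begin

text \<open>
  Both sums satisfy the stated third-order recurrence and have the same first three values.

  For the double sum, the \<open>q\<close>-binomial series give the generating function
  \[ G(x) = \sum_n P_n x^n = \sum_j \frac{q^{2j^2+2j} x^{2j}}{(-qx;q)_{2j} (x;q^2)_{j+1}} . \]
  Multiplication by \<open>(1 - x)(1 + q x)(1 + q^2 x)\<close> turns the summand with index \<open>j + 1\<close> into
  \<open>q^4 x^2\<close> times the summand with index \<open>j\<close> at \<open>q^2 x\<close> (\<open>term_fps_step\<close>), whence
  \[ (1 - x)(1 + q x)(1 + q^2 x)\, G(x) = (1 + q x)(1 + q^2 x) + q^4 x^2\, G(q^2 x) . \]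
  The coefficients of \<open>x^n\<close> on both sides are the recurrence and the initial values.

  For the bilateral sum, let \<open>N = n + 1\<close> and let \<open>\<langle>r\<rangle>_N\<close> be the Gaussian
  polynomial in base \<open>q^2\<close> with upper entry \<open>N\<close> and lower entry \<open>(N + r)/2\<close>, or \<open>0\<close> if
  \<open>N + r\<close> is odd. Whatever the parity of \<open>N\<close>, the floor in the lower entry selects the one of
  two neighbouring values of \<open>r\<close> that has the right parity: \<open>r = 7m, 7m + 1\<close> for the index
  \<open>j = 2m\<close> and \<open>r = 7m + 4, 7m + 5\<close> for \<open>j = 2m + 1\<close>. So the floor disappears and the sum is
  \<open>S_0 + S_1\<close> (\<open>bilateral_sum_eq\<close>), where \<open>S_0\<close> collects the outer residues \<open>0, 5\<close> modulo 7 and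
  \<open>S_1\<close> the inner residues \<open>1, 4\<close>. The two Pascal rules
  \[ \langle r\rangle_{N+1} = \langle r+1\rangle_N + q^{N+1-r} \langle r-1\rangle_N
       = \langle r-1\rangle_N + q^{N+1+r} \langle r+1\rangle_N \]
  move the residues by one. If the rule is chosen for each residue so that the unweighted terms
  exchange \<open>0\<close> and \<open>1\<close>, \<open>2\<close> and \<open>3\<close>, \<open>4\<close> and \<open>5\<close>, then the quadratic exponents make the weighted
  terms at the residue \<open>6\<close> cancel, and with a third sum \<open>S_2\<close> over the residues \<open>2, 3\<close> the
  system closes:
  \[ S_0(N+1) = S_1(N), \quad S_1(N+1) = S_0(N) + q^{N+1} S_2(N), \quad
     S_2(N+1) = q^N S_1(N) - S_2(N) . \]
  Elimination of \<open>S_2\<close> leaves the same recurrence for \<open>S_0 + S_1\<close> (\<open>bilateral_rec\<close>).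
\<close>

section \<open>Gaussian polynomials\<close>

lemma qpoch_Suc: "qpoch p p (Suc n) = qpoch p p n * (1 - p ^ Suc n)"
  by (simp add: qpoch_def)

lemma qpoch_nonzero:
  fixes p :: "'a::field"
  assumes "\<And>i. i > 0 \<Longrightarrow> p ^ i \<noteq> 1"
  shows "qpoch p p n \<noteq> 0"
proof (induction n)
  case 0
  show ?case by (simp add: qpoch_def)
next
  case (Suc n)
  then show ?case using assms[of "Suc n"] by (simp add: qpoch_Suc del: power_Suc)
qed

lemma gauss_poly_outside: "B < 0 \<or> A < B \<Longrightarrow> gauss_poly p A B = 0"
  by (auto simp: gauss_poly_def)

lemma gauss_poly_0:
  fixes p :: "'a::field"
  assumes "\<And>i. i > 0 \<Longrightarrow> p ^ i \<noteq> 1" and "0 \<le> A"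
  shows "gauss_poly p A 0 = 1"
  using assms(2) qpoch_nonzero[OF assms(1), of "nat A"]
  by (simp add: gauss_poly_def) (simp add: qpoch_def)

lemma gauss_poly_self:
  fixes p :: "'a::field"
  assumes "\<And>i. i > 0 \<Longrightarrow> p ^ i \<noteq> 1" and "0 \<le> A"
  shows "gauss_poly p A A = 1"
  using assms(2) qpoch_nonzero[OF assms(1), of "nat A"]
  by (simp add: gauss_poly_def) (simp add: qpoch_def)

lemma gauss_poly_sym: "gauss_poly p A (A - B) = gauss_poly p A B"
  by (auto simp: gauss_poly_def mult.commute)

text \<open>After division by the common factor, this is
  \<open>1 - p^(b+d+2) = (1 - p^(b+1)) + p^(b+1) (1 - p^(d+1))\<close>. The case \<open>A = - 1\<close> has to be excluded:
  for \<open>B = 0\<close> the left-hand side is \<open>1\<close> and the right-hand side \<open>0\<close>.\<close>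

lemma gauss_poly_pascal:
  fixes p :: "'a::field"
  assumes p: "\<And>i. i > 0 \<Longrightarrow> p ^ i \<noteq> 1" and A: "0 \<le> A"
  shows "gauss_poly p (A + 1) B = gauss_poly p A (B - 1) + p powi B * gauss_poly p A B"
proof -
  consider "B < 0 \<or> A + 1 < B" | "B = 0" | "B = A + 1" | "1 \<le> B \<and> B \<le> A" by linarith
  then show ?thesis
  proof cases
    case 1
    then show ?thesis using A by (auto simp: gauss_poly_outside)
  next
    case 2
    then show ?thesis using A by (simp add: gauss_poly_0[OF p] gauss_poly_outside)
  next
    case 3
    then show ?thesis using A by (simp add: gauss_poly_self[OF p] gauss_poly_outside)
  next
    case 4
    define b d where "b = nat (B - 1)" and "d = nat (A - B)"
    have B: "B = int b + 1" and AB: "A = int b + 1 + int d"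
      using 4 by (simp_all add: b_def d_def)
    have nats: "nat (A + 1) = Suc (Suc (b + d))" "nat A = Suc (b + d)"
      "nat B = Suc b" "nat (A + 1 - B) = Suc d" "nat (A - B) = d" "nat (B - 1) = b"
      "nat (A - (B - 1)) = Suc d"
      by (simp_all add: B AB nat_add_distrib)
    have powi: "p powi B = p ^ Suc b"
      by (simp add: B power_int_def nat_add_distrib)
    define U V W where "U = qpoch p p b" and "V = qpoch p p d" and "W = qpoch p p (Suc (b + d))"
    define u v where "u = 1 - p ^ Suc b" and "v = 1 - p ^ Suc d"
    have nz: "U \<noteq> 0" "V \<noteq> 0" "u \<noteq> 0" "v \<noteq> 0"
      using qpoch_nonzero[OF p] p[of "Suc b"] p[of "Suc d"]
      by (auto simp: U_def V_def u_def v_def simp del: power_Suc)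
    have split: "1 - p ^ Suc (Suc (b + d)) = u + p ^ Suc b * v"
      by (simp add: u_def v_def algebra_simps power_add)
    have g1: "gauss_poly p (A + 1) B = W * (1 - p ^ Suc (Suc (b + d))) / ((U * u) * (V * v))"
      using 4 by (simp add: gauss_poly_def nats U_def V_def W_def u_def v_def qpoch_Suc[of p "Suc (b+d)"]
            qpoch_Suc[of p b] qpoch_Suc[of p d] del: power_Suc)
    have g2: "gauss_poly p A (B - 1) = W / (U * (V * v))"
      using 4 by (simp add: gauss_poly_def nats U_def V_def W_def v_def qpoch_Suc[of p d] del: power_Suc)
    have g3: "gauss_poly p A B = W / ((U * u) * V)"
      using 4 by (simp add: gauss_poly_def nats U_def V_def W_def u_def qpoch_Suc[of p b] del: power_Suc)
    show ?thesis
      unfolding g1 g2 g3 split powi using nz by (simp add: field_simps)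
  qed
qed

lemma gauss_poly_pascal':
  fixes p :: "'a::field"
  assumes p: "\<And>i. i > 0 \<Longrightarrow> p ^ i \<noteq> 1" and A: "0 \<le> A"
  shows "gauss_poly p (A + 1) B = p powi (A + 1 - B) * gauss_poly p A (B - 1) + gauss_poly p A B"
proof -
  have "gauss_poly p (A + 1) B = gauss_poly p (A + 1) (A + 1 - B)"
    by (simp add: gauss_poly_sym)
  also have "\<dots> = gauss_poly p A (A - B) + p powi (A + 1 - B) * gauss_poly p A (A - (B - 1))"
    using gauss_poly_pascal[OF p A, of "A + 1 - B"] by (simp add: algebra_simps)
  finally show ?thesis by (simp add: gauss_poly_sym)
qed

lemma q_power: "q ^ i = Fraction_Field.Fract (monom 1 i) 1"
proof (induction i)
  case 0
  show ?case by (simp add: monom_0 One_fract_def pCons_one)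
next
  case (Suc i)
  then show ?case by (simp add: q_def monom_Suc)
qed

lemma q_nonzero: "q \<noteq> 0"
  by (simp add: q_def Zero_fract_def eq_fract)

lemma q_not_root_of_unity: "i > 0 \<Longrightarrow> q ^ i \<noteq> 1"
proof
  assume "i > 0" "q ^ i = 1"
  then have "monom (1::int) i = 1"
    by (simp add: q_power One_fract_def eq_fract)
  then have "degree (monom (1::int) i) = degree (1 :: int poly)" by simp
  then show False using \<open>i > 0\<close> by (simp add: degree_monom_eq)
qed

lemma q2_not_root_of_unity: "i > 0 \<Longrightarrow> (q ^ 2) ^ i \<noteq> 1"
  using q_not_root_of_unity[of "2 * i"] by (simp add: power_mult)

lemma q_powi_add: "q powi (a + b) = q powi a * q powi b"
  using q_nonzero by (simp add: power_int_add)

lemma q2_powi: "(q ^ 2) powi a = q powi (2 * a)"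
  using power_int_mult[of q 2 a] by simp

section \<open>The generating function of the double sum\<close>

text \<open>This is the power series \<open>1 / (-qx;q)_m\<close>, given by its coefficients because those occur in
  the double sum. The exceptional value at \<open>m = k = 0\<close> makes it equal to \<open>1\<close> for \<open>m = 0\<close>.\<close>

definition binom_fps :: "nat \<Rightarrow> int poly fract fps" where
  "binom_fps m = Abs_fps (\<lambda>k. (- q) ^ k *
     (if m = 0 \<and> k = 0 then 1 else gauss_poly q (int m + int k - 1) (int k)))"

text \<open>This is the power series \<open>x^j / (x;q^2)_(j+1)\<close>.\<close>

definition gauss_fps :: "nat \<Rightarrow> int poly fract fps" where
  "gauss_fps j = Abs_fps (\<lambda>n. gauss_poly (q ^ 2) (int n) (int j))"

definition term_fps :: "nat \<Rightarrow> int poly fract fps" where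
  "term_fps j = fps_const (q ^ (2 * j ^ 2 + 2 * j)) * fps_X ^ j * binom_fps (2 * j) * gauss_fps j"

abbreviation dilate :: "int poly fract \<Rightarrow> int poly fract fps \<Rightarrow> int poly fract fps" where
  "dilate c F \<equiv> fps_compose F (fps_const c * fps_X)"

lemma dilate_nth: "fps_nth (dilate c F) n = c ^ n * fps_nth F n"
  by (simp add: fps_compose_linear)

text \<open>In terms of products, the first factor of \<open>(-qx;q)_(m+1)\<close> is removed; the remaining ones
  are those of \<open>(-qx;q)_m\<close> at \<open>qx\<close>. On coefficients this is a Pascal rule.\<close>

lemma binom_fps_step:
  "(1 + fps_const q * fps_X) * binom_fps (Suc m) = dilate q (binom_fps m)"
proof (rule fps_ext)
  fix k
  show "fps_nth ((1 + fps_const q * fps_X) * binom_fps (Suc m)) k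
      = fps_nth (dilate q (binom_fps m)) k"
  proof (cases k)
    case 0
    then show ?thesis
      by (auto simp: dilate_nth binom_fps_def distrib_right mult.assoc gauss_poly_0 q_not_root_of_unity)
  next
    case (Suc l)
    have "gauss_poly q (int m + int k) (int k)
        = gauss_poly q (int m + int l) (int l) + q ^ k * gauss_poly q (int m + int l) (int k)"
      using gauss_poly_pascal[OF q_not_root_of_unity, of "int m + int l" "int k"]
      by (simp add: Suc power_int_def nat_add_distrib add_ac)
    then show ?thesis
      by (simp add: Suc dilate_nth binom_fps_def distrib_right mult.assoc add.commute)
         (simp add: algebra_simps)
  qed
qed

lemma gauss_fps_0: "(1 - fps_X) * gauss_fps 0 = 1"
proof (rule fps_ext)
  fix n show "fps_nth ((1 - fps_X) * gauss_fps 0) n = fps_nth 1 n"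
    by (cases n) (simp_all add: gauss_fps_def left_diff_distrib gauss_poly_0 q2_not_root_of_unity)
qed

text \<open>The other Pascal rule, read as the removal of the first factor of \<open>(x;q^2)_(j+2)\<close>. The
  constant compensates \<open>x^j\<close>, which the dilation multiplies by \<open>q^(2j)\<close>.\<close>

lemma gauss_fps_step:
  "fps_const (q ^ (2 * j)) * ((1 - fps_X) * gauss_fps (Suc j))
     = fps_X * dilate (q ^ 2) (gauss_fps j)"
proof (rule fps_ext)
  fix n
  show "fps_nth (fps_const (q ^ (2 * j)) * ((1 - fps_X) * gauss_fps (Suc j))) n
      = fps_nth (fps_X * dilate (q ^ 2) (gauss_fps j)) n"
  proof (cases n)
    case 0
    then show ?thesis by (simp add: gauss_fps_def gauss_poly_outside left_diff_distrib)
  next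
    case (Suc l)
    have "gauss_poly (q^2) (int n) (int (Suc j)) - gauss_poly (q^2) (int l) (int (Suc j))
       = (q^2) powi (int l - int j) * gauss_poly (q^2) (int l) (int j)"
      using gauss_poly_pascal'[OF q2_not_root_of_unity, of "int l" "int (Suc j)"]
      by (simp add: Suc add.commute)
    moreover have "q ^ (2 * j) * (q^2) powi (int l - int j) = (q^2) ^ l"
    proof -
      have "(q^2) powi int j * (q^2) powi (int l - int j) = (q^2) powi int l"
        using q_nonzero by (subst power_int_add[symmetric]) auto
      then show ?thesis by (simp add: power_mult)
    qed
    ultimately show ?thesis
      by (simp add: Suc gauss_fps_def left_diff_distrib dilate_nth mult.assoc[symmetric])
  qed
qed

lemma term_fps_0: "(1 - fps_X) * term_fps 0 = 1"
proof -
  have "binom_fps 0 = 1"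
  proof (rule fps_ext)
    fix k show "fps_nth (binom_fps 0) k = fps_nth 1 k"
      by (cases k) (simp_all add: binom_fps_def gauss_poly_outside)
  qed
  then show ?thesis by (simp add: term_fps_def gauss_fps_0)
qed

text \<open>Its coefficients are those of the recurrence, apart from the term with \<open>q^(2n)\<close>, which
  comes from the dilation by \<open>q^2\<close>.\<close>

definition P_denominator :: "int poly fract fps" where
  "P_denominator = (1 - fps_X) * (1 + fps_const q * fps_X) * (1 + fps_const (q ^ 2) * fps_X)"

lemma binom_fps_step2:
  "(1 + fps_const q * fps_X) * (1 + fps_const (q ^ 2) * fps_X) * binom_fps (Suc (Suc m))
     = dilate (q ^ 2) (binom_fps m)"
proof -
  have "(1 + fps_const (q ^ 2) * fps_X) = dilate q (1 + fps_const q * fps_X)"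
  proof (rule fps_ext)
    fix n
    show "fps_nth (1 + fps_const (q ^ 2) * fps_X) n = fps_nth (dilate q (1 + fps_const q * fps_X)) n"
      by (cases "n = 1") (auto simp: dilate_nth power2_eq_square)
  qed
  then have "(1 + fps_const (q ^ 2) * fps_X) * ((1 + fps_const q * fps_X) * binom_fps (Suc (Suc m)))
     = dilate q ((1 + fps_const q * fps_X) * binom_fps (Suc m))"
    by (simp only: binom_fps_step fps_compose_mult_distrib[symmetric] fps_mult_nth_0 fps_X_nth if_False zero_neq_one mult_zero_right)
  also have "\<dots> = dilate (q ^ 2) (binom_fps m)"
    unfolding binom_fps_step
    by (rule fps_ext) (simp add: dilate_nth power_mult_distrib power2_eq_square)
  finally show ?thesis by (simp add: mult_ac)
qed

text \<open>The three factors of the denominator are exactly the first factors of the two products in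
  the summand with index \<open>j + 1\<close>; without them these are the products for \<open>j\<close> at \<open>q^2 x\<close>. The
  power of \<open>q\<close> fits since \<open>2(j+1)^2 + 2(j+1) = 2j^2 + 2j + 4j + 4\<close>.\<close>

lemma term_fps_step:
  "P_denominator * term_fps (Suc j) = fps_const (q ^ 4) * fps_X ^ 2 * dilate (q ^ 2) (term_fps j)"
proof -
  have e: "2 * (Suc j)^2 + 2 * Suc j = (4 + (2 * j ^ 2 + 2 * j) + 2 * j) + 2 * j"
    by (simp add: power2_eq_square)
  have dX: "dilate (q ^ 2) (fps_X ^ j) = fps_const (q ^ (2 * j)) * fps_X ^ j"
    by (rule fps_ext) (simp add: dilate_nth fps_X_power_nth power_mult)
  have d: "dilate (q^2) (term_fps j) = fps_const (q ^ (2 * j ^ 2 + 2 * j))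
      * (fps_const (q ^ (2 * j)) * fps_X ^ j) * dilate (q^2) (binom_fps (2 * j)) * dilate (q^2) (gauss_fps j)"
    unfolding term_fps_def by (simp add: fps_compose_mult_distrib dX)
  have "P_denominator * term_fps (Suc j)
     = fps_const (q ^ 4) * fps_const (q ^ (2 * j ^ 2 + 2 * j)) * fps_const (q ^ (2 * j)) * fps_X ^ Suc j
       * ((1 + fps_const q * fps_X) * (1 + fps_const (q ^ 2) * fps_X) * binom_fps (Suc (Suc (2 * j))))
       * (fps_const (q ^ (2 * j)) * ((1 - fps_X) * gauss_fps (Suc j)))"
    unfolding P_denominator_def term_fps_def e power_add fps_const_mult[symmetric] by (simp add: mult_ac)
  also have "\<dots> = fps_const (q ^ 4) * fps_X ^ 2 * dilate (q ^ 2) (term_fps j)"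
    unfolding binom_fps_step2 gauss_fps_step d by (simp add: power2_eq_square mult_ac)
  finally show ?thesis .
qed

lemma term_fps_nth: "fps_nth (term_fps j) n = (\<Sum>k\<le>n. P_summand n j k)"
proof (cases "j \<le> n")
  case True
  have "fps_nth (term_fps j) n
     = q ^ (2 * j ^ 2 + 2 * j) * fps_nth (binom_fps (2 * j) * gauss_fps j) (n - j)"
    using True by (simp add: term_fps_def mult.assoc fps_X_power_mult_nth)
  also have "\<dots> = (\<Sum>k\<le>n - j. P_summand n j k)"
  proof -
    have "q ^ (2 * j ^ 2 + 2 * j) * (fps_nth (binom_fps (2 * j)) k * fps_nth (gauss_fps j) (n - j - k))
        = P_summand n j k" if "k \<le> n - j" for k
      using that True
      by (auto simp: P_summand_def binom_fps_def gauss_fps_def first_factor_def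
          power_add of_nat_diff power_minus[of q] diff_diff_eq)
    then show ?thesis
      by (simp add: fps_mult_nth sum_distrib_left atLeast0AtMost)
  qed
  also have "\<dots> = (\<Sum>k\<le>n. P_summand n j k)"
    by (rule sum.mono_neutral_left) (auto intro!: P_summand_eq_0)
  finally show ?thesis .
next
  case False
  then show ?thesis
    by (simp add: term_fps_def mult.assoc fps_X_power_mult_nth P_summand_eq_0)
qed

lemma P_eq_sum_term_fps:
  assumes "n \<le> J"
  shows "P n = (\<Sum>j\<le>J. fps_nth (term_fps j) n)"
proof -
  have row: "Sum_any (P_summand n j) = fps_nth (term_fps j) n" for j
    unfolding term_fps_nth
  proof (rule Sum_any.expand_superset)
    show "{k. P_summand n j k \<noteq> 0} \<subseteq> {..n}"
      using P_summand_eq_0[of n j] by (force simp: not_le[symmetric])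
  qed simp
  have "P n = Sum_any (\<lambda>j. fps_nth (term_fps j) n)"
    unfolding P_def using row by simp
  also have "\<dots> = (\<Sum>j\<le>J. fps_nth (term_fps j) n)"
  proof (rule Sum_any.expand_superset)
    have "fps_nth (term_fps j) n = 0" if "j > J" for j
      unfolding term_fps_nth using that assms by (intro sum.neutral) (auto intro: P_summand_eq_0)
    then show "{j. fps_nth (term_fps j) n \<noteq> 0} \<subseteq> {..J}"
      by (force simp flip: not_less)
  qed simp
  finally show ?thesis .
qed

lemma P_denominator_nth:
  "fps_nth (P_denominator * F) n = fps_nth F n - (1 - q - q ^ 2) * (if n < 1 then 0 else fps_nth F (n - 1))
     - (- (q ^ 3) + q ^ 2 + q) * (if n < 2 then 0 else fps_nth F (n - 2))
     - q ^ 3 * (if n < 3 then 0 else fps_nth F (n - 3))"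
proof -
  have eq: "P_denominator = 1 - fps_const (1 - q - q ^ 2) * fps_X ^ 1
     - fps_const (- (q ^ 3) + q ^ 2 + q) * fps_X ^ 2 - fps_const (q ^ 3) * fps_X ^ 3"
  proof -
    have "P_denominator = (1 - fps_X) * (1 + fps_const q * fps_X) * (1 + fps_const q ^ 2 * fps_X)"
      by (simp add: P_denominator_def fps_const_power)
    also have "\<dots> = 1 - (1 - fps_const q - fps_const q ^ 2) * fps_X ^ 1
     - (- (fps_const q ^ 3) + fps_const q ^ 2 + fps_const q) * fps_X ^ 2 - fps_const q ^ 3 * fps_X ^ 3"
      by algebra
    finally show ?thesis
      by (simp add: fps_const_power fps_const_sub[symmetric] fps_const_add[symmetric] fps_const_neg[symmetric]
           del: fps_const_sub fps_const_add fps_const_neg)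
  qed
  show ?thesis
    unfolding eq left_diff_distrib[where 'a = "int poly fract fps"] mult.assoc
    by (simp add: fps_X_power_mult_nth del: power_one_right)
qed

text \<open>Summation of the preceding relation over \<open>j\<close>. The coefficient of \<open>x^n\<close> depends on finitely
  many summands only, so partial sums suffice.\<close>

lemma P_generating_function:
  "P_denominator * Abs_fps P = (1 + fps_const q * fps_X) * (1 + fps_const (q ^ 2) * fps_X)
     + fps_const (q ^ 4) * fps_X ^ 2 * dilate (q ^ 2) (Abs_fps P)"
proof (rule fps_ext)
  fix n
  define G where "G J = (\<Sum>j\<le>J. term_fps j)" for J
  have G: "fps_nth (G J) i = P i" if "i \<le> J" for i J
    using P_eq_sum_term_fps[OF that] by (simp add: G_def fps_sum_nth)
  have "P_denominator * G (Suc n) = P_denominator * term_fps 0 + (\<Sum>j\<le>n. P_denominator * term_fps (Suc j))"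
    unfolding G_def by (subst sum.atMost_Suc_shift) (simp add: distrib_left sum_distrib_left)
  also have "P_denominator * term_fps 0 = (1 + fps_const q * fps_X) * (1 + fps_const (q ^ 2) * fps_X)"
    using term_fps_0 by (simp add: P_denominator_def mult_ac)
  also have "(\<Sum>j\<le>n. P_denominator * term_fps (Suc j))
      = fps_const (q ^ 4) * fps_X ^ 2 * dilate (q ^ 2) (G n)"
    unfolding term_fps_step G_def by (simp add: fps_compose_sum_distrib sum_distrib_left)
  finally have eq: "P_denominator * G (Suc n) = (1 + fps_const q * fps_X) * (1 + fps_const (q ^ 2) * fps_X)
     + fps_const (q ^ 4) * fps_X ^ 2 * dilate (q ^ 2) (G n)" .
  have "fps_nth (P_denominator * Abs_fps P) n = fps_nth (P_denominator * G (Suc n)) n"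
    by (simp add: P_denominator_nth G)
  also have "fps_nth (fps_const (q ^ 4) * fps_X ^ 2 * dilate (q ^ 2) (G n)) n
      = fps_nth (fps_const (q ^ 4) * fps_X ^ 2 * dilate (q ^ 2) (Abs_fps P)) n"
    by (simp add: mult.assoc fps_X_power_mult_nth dilate_nth G)
  then have "fps_nth (P_denominator * G (Suc n)) n = fps_nth ((1 + fps_const q * fps_X) * (1 + fps_const (q ^ 2) * fps_X)
     + fps_const (q ^ 4) * fps_X ^ 2 * dilate (q ^ 2) (Abs_fps P)) n"
    unfolding eq by simp
  finally show "fps_nth (P_denominator * Abs_fps P) n = fps_nth ((1 + fps_const q * fps_X) * (1 + fps_const (q ^ 2) * fps_X)
     + fps_const (q ^ 4) * fps_X ^ 2 * dilate (q ^ 2) (Abs_fps P)) n" .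
qed

lemma P_coefficients:
  "P n - (1 - q - q ^ 2) * (if n < 1 then 0 else P (n - 1))
     - (- (q ^ 3) + q ^ 2 + q) * (if n < 2 then 0 else P (n - 2))
     - q ^ 3 * (if n < 3 then 0 else P (n - 3))
   = (if n = 0 then 1 else if n = 1 then q + q ^ 2 else if n = 2 then q ^ 3 else 0)
     + (if n < 2 then 0 else q ^ (2 * n) * P (n - 2))"
proof -
  have "(1 + fps_const q * fps_X) * (1 + fps_const (q ^ 2) * fps_X)
     = 1 + fps_const (q + q ^ 2) * fps_X ^ 1 + fps_const (q ^ 3) * fps_X ^ 2"
  proof -
    have "(1 + fps_const q * fps_X) * (1 + fps_const q ^ 2 * fps_X)
     = 1 + (fps_const q + fps_const q ^ 2) * fps_X ^ 1 + fps_const q ^ 3 * fps_X ^ 2"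
      by algebra
    then show ?thesis by (simp add: fps_const_power fps_const_add[symmetric] del: fps_const_add)
  qed
  then have 1: "fps_nth ((1 + fps_const q * fps_X) * (1 + fps_const (q ^ 2) * fps_X)) n
     = (if n = 0 then 1 else if n = 1 then q + q ^ 2 else if n = 2 then q ^ 3 else 0)"
    by (simp add: fps_X_power_nth)
  have 2: "fps_nth (fps_const (q ^ 4) * fps_X ^ 2 * dilate (q ^ 2) (Abs_fps P)) n
     = (if n < 2 then 0 else q ^ (2 * n) * P (n - 2))"
  proof (cases "n < 2")
    case False
    then have "2 * n = 4 + 2 * (n - 2)" by simp
    then have "q ^ 4 * (q ^ 2) ^ (n - 2) = q ^ (2 * n)"
      by (metis power_add power_mult)
    then show ?thesis using False
      by (simp add: mult.assoc fps_X_power_mult_nth dilate_nth flip: mult.assoc[of "q ^ 4" "(q ^ 2) ^ (n - 2)"])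
  qed (simp add: mult.assoc fps_X_power_mult_nth)
  have "fps_nth (P_denominator * Abs_fps P) n
      = fps_nth ((1 + fps_const q * fps_X) * (1 + fps_const (q ^ 2) * fps_X)
          + fps_const (q ^ 4) * fps_X ^ 2 * dilate (q ^ 2) (Abs_fps P)) n"
    by (simp only: P_generating_function)
  then show ?thesis
    unfolding P_denominator_nth fps_add_nth 1 2 fps_nth_Abs_fps .
qed

lemma P_0: "P 0 = 1" and P_1: "P 1 = 1" and P_2: "P 2 = q ^ 4 + 1"
proof -
  show 0: "P 0 = 1" using P_coefficients[of 0] by simp
  show 1: "P 1 = 1" using P_coefficients[of 1] 0 by (simp add: algebra_simps)
  have "P (2 - Suc 0) = 1" using 1 by simp
  then show "P 2 = q ^ 4 + 1" using P_coefficients[of 2] 0 by (simp add: algebra_simps)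
qed

lemma P_rec:
  "n \<ge> 3 \<Longrightarrow> P n = (1 - q - q ^ 2) * P (n - 1)
            + (q ^ (2 * n) - q ^ 3 + q ^ 2 + q) * P (n - 2) + q ^ 3 * P (n - 3)"
  using P_coefficients[of n] by (simp add: algebra_simps)

section \<open>Bilateral sums along residue classes modulo 7\<close>

text \<open>The coordinate \<open>r\<close>, twice the distance of the lower entry from the centre, makes both
  Pascal rules symmetric, and lets a single formula cover both parities of \<open>N\<close>.\<close>

definition centred_gauss :: "nat \<Rightarrow> int \<Rightarrow> int poly fract" where
  "centred_gauss N r =
     (if even (int N + r) then gauss_poly (q ^ 2) (int N) ((int N + r) div 2) else 0)"

lemma centred_gauss_0: "centred_gauss 0 r = (if r = 0 then 1 else 0)"
  by (auto simp: centred_gauss_def gauss_poly_0 q2_not_root_of_unity elim!: evenE intro!: gauss_poly_outside)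

lemma centred_gauss_outside: "\<bar>r\<bar> > int N \<Longrightarrow> centred_gauss N r = 0"
proof -
  assume r: "\<bar>r\<bar> > int N"
  have "(int N + r) div 2 < 0 \<or> int N < (int N + r) div 2" if "even (int N + r)"
    using that r by presburger
  then show ?thesis by (auto simp only: centred_gauss_def gauss_poly_outside split: if_splits)
qed

lemma centred_gauss_up:
  "centred_gauss (Suc N) r = centred_gauss N (r + 1)
     + q powi (int N + 1 - r) * centred_gauss N (r - 1)"
proof (cases "even (int (Suc N) + r)")
  case True
  then obtain k where k: "int (Suc N) + r = 2 * k" by (elim evenE)
  then have r: "r = 2 * k - int N - 1" by simp
  have "(q ^ 2) powi (int N + 1 - k) = q powi (int N + 1 - r)"
    by (simp add: q2_powi r algebra_simps)
  moreover have "(int N + (r - 1)) div 2 = k - 1" "(int N + (r + 1)) div 2 = k" "(int (Suc N) + r) div 2 = k"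
    "even (int N + (r - 1))" "even (int N + (r + 1))" "even (int (Suc N) + r)"
    by (simp_all add: r)
  ultimately show ?thesis
    using gauss_poly_pascal'[OF q2_not_root_of_unity, of "int N" k]
    by (simp only: centred_gauss_def if_True of_nat_Suc add.commute mult.commute)
next
  case False
  then have "odd (int N + (r + 1))" "odd (int N + (r - 1))" by simp_all
  with False show ?thesis unfolding centred_gauss_def by simp
qed

lemma centred_gauss_down:
  "centred_gauss (Suc N) r = centred_gauss N (r - 1)
     + q powi (int N + 1 + r) * centred_gauss N (r + 1)"
proof (cases "even (int (Suc N) + r)")
  case True
  then obtain k where k: "int (Suc N) + r = 2 * k" by (elim evenE)
  then have r: "r = 2 * k - int N - 1" by simp
  have "(q ^ 2) powi k = q powi (int N + 1 + r)"
    by (simp add: q2_powi r)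
  moreover have "(int N + (r - 1)) div 2 = k - 1" "(int N + (r + 1)) div 2 = k" "(int (Suc N) + r) div 2 = k"
    "even (int N + (r - 1))" "even (int N + (r + 1))" "even (int (Suc N) + r)"
    by (simp_all add: r)
  ultimately show ?thesis
    using gauss_poly_pascal[OF q2_not_root_of_unity, of "int N" k]
    by (simp only: centred_gauss_def if_True of_nat_Suc add.commute mult.commute)
next
  case False
  then have "odd (int N + (r + 1))" "odd (int N + (r - 1))" by simp_all
  with False show ?thesis unfolding centred_gauss_def by simp
qed

lemma Sum_any_reindex:
  fixes g :: "'b \<Rightarrow> 'c::comm_monoid_add"
  assumes "inj h" "{x. g x \<noteq> 0} \<subseteq> range h"
  shows "Sum_any g = Sum_any (\<lambda>m. g (h m))"
proof -
  have "{x. g x \<noteq> 0} = h ` {m. g (h m) \<noteq> 0}" using assms(2) by auto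
  then show ?thesis
    using assms(1) by (simp add: Sum_any.expand_set sum.reindex inj_on_subset)
qed

lemma Sum_any_even_odd:
  fixes g :: "int \<Rightarrow> 'c::comm_monoid_add"
  assumes "finite {j. g j \<noteq> 0}"
  shows "Sum_any g = Sum_any (\<lambda>m. g (2 * m)) + Sum_any (\<lambda>m. g (2 * m + 1))"
proof -
  define g0 g1 where "g0 j = (if even j then g j else 0)" and "g1 j = (if odd j then g j else 0)" for j
  have "Sum_any g = Sum_any (\<lambda>j. g0 j + g1 j)"
    by (rule arg_cong[of _ _ Sum_any]) (auto simp: g0_def g1_def)
  also have "\<dots> = Sum_any g0 + Sum_any g1"
    by (rule Sum_any.distrib; rule finite_subset[OF _ assms]) (auto simp: g0_def g1_def)
  also have "Sum_any g0 = Sum_any (\<lambda>m. g (2 * m))"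
    by (subst Sum_any_reindex[of "\<lambda>m. 2 * m"]) (auto simp: g0_def inj_def elim!: evenE split: if_splits)
  also have "Sum_any g1 = Sum_any (\<lambda>m. g (2 * m + 1))"
    by (subst Sum_any_reindex[of "\<lambda>m. 2 * m + 1"]) (auto simp: g1_def inj_def elim!: oddE split: if_splits)
  finally show ?thesis .
qed

definition mod7_sum :: "(int \<Rightarrow> int poly fract) \<Rightarrow> int \<Rightarrow> nat \<Rightarrow> int poly fract" where
  "mod7_sum w s N = Sum_any (\<lambda>m. w m * centred_gauss N (7 * m + s))"

lemma mod7_sum_finite: "finite {m. w m * centred_gauss N (7 * m + s) \<noteq> 0}"
proof (rule finite_subset)
  show "{m. w m * centred_gauss N (7 * m + s) \<noteq> 0} \<subseteq> {- int N - \<bar>s\<bar>..int N + \<bar>s\<bar>}"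
  proof
    fix m assume "m \<in> {m. w m * centred_gauss N (7 * m + s) \<noteq> 0}"
    then have "\<bar>7 * m + s\<bar> \<le> int N" using centred_gauss_outside[of N "7 * m + s"] by force
    then show "m \<in> {- int N - \<bar>s\<bar>..int N + \<bar>s\<bar>}" by auto
  qed
qed simp

lemma mod7_sum_shift: "mod7_sum w s N = mod7_sum (\<lambda>m. w (m + 1)) (s + 7) N"
  unfolding mod7_sum_def
  by (subst Sum_any_reindex[of "\<lambda>m. m + 1"]) (auto simp: algebra_simps surj_def intro: exI[of _ "_ - 1"])

lemma mod7_sum_scale: "mod7_sum (\<lambda>m. c * w m) s N = c * mod7_sum w s N"
  unfolding mod7_sum_def using mod7_sum_finite[of w N s]
  by (simp add: Sum_any_right_distrib mult.assoc)

text \<open>The Pascal rules for a whole residue class. The name refers to the direction in which the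
  term without a power of \<open>q\<close> moves.\<close>

lemma mod7_sum_up:
  "mod7_sum w s (Suc N) = mod7_sum w (s + 1) N
     + q ^ Suc N * mod7_sum (\<lambda>m. w m * q powi (- (7 * m + s))) (s - 1) N"
proof -
  have "w m * centred_gauss (Suc N) (7 * m + s) = w m * centred_gauss N (7 * m + (s + 1))
     + (q ^ Suc N * (w m * q powi (- (7 * m + s)))) * centred_gauss N (7 * m + (s - 1))" for m
  proof -
    have "q powi (int N + 1 - (7 * m + s)) = q ^ Suc N * q powi (- (7 * m + s))"
      using q_powi_add[of "int (Suc N)" "- (7 * m + s)"]
      unfolding power_int_of_nat by (simp only: of_nat_Suc add.commute diff_conv_add_uminus)
    then show ?thesis
      unfolding centred_gauss_up by (simp add: algebra_simps del: power_Suc)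
  qed
  then have "mod7_sum w s (Suc N) = mod7_sum w (s + 1) N
     + mod7_sum (\<lambda>m. q ^ Suc N * (w m * q powi (- (7 * m + s)))) (s - 1) N"
    unfolding mod7_sum_def by (simp only: Sum_any.distrib[OF mod7_sum_finite mod7_sum_finite])
  then show ?thesis by (simp only: mod7_sum_scale)
qed

lemma mod7_sum_down:
  "mod7_sum w s (Suc N) = mod7_sum w (s - 1) N
     + q ^ Suc N * mod7_sum (\<lambda>m. w m * q powi (7 * m + s)) (s + 1) N"
proof -
  have "w m * centred_gauss (Suc N) (7 * m + s) = w m * centred_gauss N (7 * m + (s - 1))
     + (q ^ Suc N * (w m * q powi (7 * m + s))) * centred_gauss N (7 * m + (s + 1))" for m
  proof -
    have "q powi (int N + 1 + (7 * m + s)) = q ^ Suc N * q powi (7 * m + s)"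
      using q_powi_add[of "int (Suc N)" "7 * m + s"]
      unfolding power_int_of_nat by (simp only: of_nat_Suc add.commute)
    then show ?thesis
      unfolding centred_gauss_down by (simp add: algebra_simps del: power_Suc)
  qed
  then have "mod7_sum w s (Suc N) = mod7_sum w (s - 1) N
     + mod7_sum (\<lambda>m. q ^ Suc N * (w m * q powi (7 * m + s))) (s + 1) N"
    unfolding mod7_sum_def by (simp only: Sum_any.distrib[OF mod7_sum_finite mod7_sum_finite])
  then show ?thesis by (simp only: mod7_sum_scale)
qed

lemma mod7_sum_0: "0 \<le> s \<Longrightarrow> s < 7 \<Longrightarrow> mod7_sum w s 0 = (if s = 0 then w 0 else 0)"
proof -
  assume s: "0 \<le> s" "s < 7"
  have "w m * centred_gauss 0 (7 * m + s) = (if m = 0 then if s = 0 then w 0 else 0 else 0)" for m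
  proof -
    have "7 * m + s = 0 \<longleftrightarrow> m = 0 \<and> s = 0" using s by presburger
    then show ?thesis by (simp add: centred_gauss_0)
  qed
  then show ?thesis
    unfolding mod7_sum_def by simp
qed

text \<open>The first two are \<open>q^(j(7j+3)/2)\<close> for \<open>j = 2m\<close> and \<open>j = 2m + 1\<close>. The third is what a
  weighted Pascal step makes of either of them when it enters the residues 2 and 3.\<close>

definition even_weight :: "int \<Rightarrow> int poly fract" where "even_weight m = q powi (14 * m ^ 2 + 3 * m)"
definition odd_weight :: "int \<Rightarrow> int poly fract" where "odd_weight m = q powi (14 * m ^ 2 + 17 * m + 5)"
definition middle_weight :: "int \<Rightarrow> int poly fract" where "middle_weight m = q powi (14 * m ^ 2 + 10 * m + 1)"

text \<open>The bilateral sum has support on the residues 0, 1, 4 and 5 modulo 7. The three sums below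
  group the residues 0 to 5 in pairs that are symmetric about the middle; the coefficients in
  each pair have opposite signs.\<close>

definition outer_sum :: "nat \<Rightarrow> int poly fract" where "outer_sum N = mod7_sum even_weight 0 N - mod7_sum odd_weight 5 N"
definition inner_sum :: "nat \<Rightarrow> int poly fract" where "inner_sum N = mod7_sum even_weight 1 N - mod7_sum odd_weight 4 N"
definition middle_sum :: "nat \<Rightarrow> int poly fract" where "middle_sum N = mod7_sum middle_weight 2 N - mod7_sum middle_weight 3 N"

text \<open>The unweighted terms move from 0 to 1 and from 5 to 4. The weighted ones both end up in
  the residue class of 6, with equal coefficients and opposite signs.\<close>

lemma outer_sum_Suc: "outer_sum (Suc N) = inner_sum N"
proof -
  \<comment> \<open>\<open>7m - 1 = 7(m - 1) + 6\<close>\<close>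
  have "mod7_sum (\<lambda>m. even_weight m * q powi (- (7 * m + 0))) (0 - 1) N
      = mod7_sum (\<lambda>m. odd_weight m * q powi (7 * m + 5)) (5 + 1) N"
    by (subst mod7_sum_shift)
       (simp add: even_weight_def odd_weight_def power2_eq_square algebra_simps flip: q_powi_add)
  then show ?thesis
    unfolding outer_sum_def inner_sum_def mod7_sum_up[of even_weight] mod7_sum_down[of odd_weight] by simp
qed

text \<open>The unweighted terms move from 1 to 0 and from 4 to 5, the weighted ones to 2 and 3.\<close>

lemma inner_sum_Suc: "inner_sum (Suc N) = outer_sum N + q ^ Suc N * middle_sum N"
proof -
  have "(\<lambda>m. even_weight m * q powi (7 * m + 1)) = middle_weight"
    "(\<lambda>m. odd_weight m * q powi (- (7 * m + 4))) = middle_weight"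
    by (rule ext, simp add: even_weight_def odd_weight_def middle_weight_def algebra_simps flip: q_powi_add)+
  then show ?thesis
    unfolding outer_sum_def inner_sum_def middle_sum_def mod7_sum_down[of even_weight] mod7_sum_up[of odd_weight]
    by (simp add: algebra_simps)
qed

text \<open>The unweighted terms exchange 2 and 3, which changes the sign; the weighted ones return to
  1 and 4, with the original weights divided by \<open>q\<close>.\<close>

lemma middle_sum_Suc: "middle_sum (Suc N) = q ^ N * inner_sum N - middle_sum N"
proof -
  have inv_q: "inverse q = q powi (- 1)"
    by (simp add: power_int_minus)
  have "(\<lambda>m. middle_weight m * q powi (- (7 * m + 2))) = (\<lambda>m. inverse q * even_weight m)"
    "(\<lambda>m. middle_weight m * q powi (7 * m + 3)) = (\<lambda>m. inverse q * odd_weight m)"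
    by (rule ext, simp only: inv_q even_weight_def odd_weight_def middle_weight_def q_powi_add[symmetric],
        simp add: algebra_simps)+
  note weights = this
  have cancel: "q ^ Suc N * (inverse q * x) = q ^ N * x" for x
    using q_nonzero by simp
  show ?thesis
    unfolding inner_sum_def middle_sum_def mod7_sum_up[of middle_weight 2] mod7_sum_down[of middle_weight 3]
    by (simp add: weights[simplified] mod7_sum_scale cancel right_diff_distrib del: power_Suc)
qed

lemma residue_sums_0: "outer_sum 0 = 1" "inner_sum 0 = 0" "middle_sum 0 = 0"
  by (simp_all add: outer_sum_def inner_sum_def middle_sum_def mod7_sum_0 even_weight_def)

section \<open>Equality of the two sums\<close>

text \<open>With \<open>N = n + 1\<close> the lower entry is the floor of \<open>(N + 7m + 3/2)/2\<close> for \<open>j = 2m\<close>, and of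
  \<open>(N + 7m + 5)/2\<close> for \<open>j = 2m + 1\<close>. The parity of \<open>N + 7m\<close> decides which of two neighbouring
  centred coefficients this is; the other one vanishes.\<close>

lemma bilateral_sum_eq:
  "Sum_any (\<lambda>j::int. (- 1) powi j * q powi (j * (7 * j + 3) div 2) *
              gauss_poly (q ^ 2) (int n + 1) ((2 * int n + 7 * j + 5) div 4))
   = outer_sum (Suc n) + inner_sum (Suc n)"
proof -
  let ?t = "\<lambda>j::int. (- 1) powi j * q powi (j * (7 * j + 3) div 2) *
              gauss_poly (q ^ 2) (int n + 1) ((2 * int n + 7 * j + 5) div 4)"
  have even: "?t (2 * m) = even_weight m * centred_gauss (Suc n) (7 * m + 0)
      + even_weight m * centred_gauss (Suc n) (7 * m + 1)" for m
  proof -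
    have "(2 * m) * (7 * (2 * m) + 3) div 2 = 14 * m ^ 2 + 3 * m"
      by (simp add: power2_eq_square algebra_simps)
    moreover have "gauss_poly (q ^ 2) (int n + 1) ((2 * int n + 7 * (2 * m) + 5) div 4)
       = centred_gauss (Suc n) (7 * m + 0) + centred_gauss (Suc n) (7 * m + 1)"
    proof (cases "even (int (Suc n) + 7 * m)")
      case True
      then have "(2 * int n + 7 * (2 * m) + 5) div 4 = (int (Suc n) + (7 * m + 0)) div 2"
        "even (int (Suc n) + (7 * m + 0))" "odd (int (Suc n) + (7 * m + 1))" by presburger+
      then show ?thesis unfolding centred_gauss_def by (simp add: add.commute)
    next
      case False
      then have "(2 * int n + 7 * (2 * m) + 5) div 4 = (int (Suc n) + (7 * m + 1)) div 2"
        "odd (int (Suc n) + (7 * m + 0))" "even (int (Suc n) + (7 * m + 1))" by presburger+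
      then show ?thesis unfolding centred_gauss_def by (simp add: add.commute)
    qed
    ultimately show ?thesis by (simp add: even_weight_def distrib_left power_int_mult)
  qed
  have odd: "?t (2 * m + 1) = (- odd_weight m) * centred_gauss (Suc n) (7 * m + 4)
      + (- odd_weight m) * centred_gauss (Suc n) (7 * m + 5)" for m
  proof -
    have "(2 * m + 1) * (7 * (2 * m + 1) + 3) = 2 * (14 * m ^ 2 + 17 * m + 5)"
      by (simp add: power2_eq_square algebra_simps)
    then have "(2 * m + 1) * (7 * (2 * m + 1) + 3) div 2 = 14 * m ^ 2 + 17 * m + 5"
      by simp
    moreover have "gauss_poly (q ^ 2) (int n + 1) ((2 * int n + 7 * (2 * m + 1) + 5) div 4)
       = centred_gauss (Suc n) (7 * m + 4) + centred_gauss (Suc n) (7 * m + 5)"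
    proof (cases "even (int (Suc n) + (7 * m + 4))")
      case True
      then have "(2 * int n + 7 * (2 * m + 1) + 5) div 4 = (int (Suc n) + (7 * m + 4)) div 2"
        "even (int (Suc n) + (7 * m + 4))" "odd (int (Suc n) + (7 * m + 5))" by presburger+
      then show ?thesis unfolding centred_gauss_def by (simp add: add.commute)
    next
      case False
      then have "(2 * int n + 7 * (2 * m + 1) + 5) div 4 = (int (Suc n) + (7 * m + 5)) div 2"
        "odd (int (Suc n) + (7 * m + 4))" "even (int (Suc n) + (7 * m + 5))" by presburger+
      then show ?thesis unfolding centred_gauss_def by (simp add: add.commute)
    qed
    moreover have "(- 1 :: int poly fract) powi (2 * m + 1) = - 1"
      by (simp add: power_int_minus_left)
    ultimately show ?thesis by (simp only: odd_weight_def) (simp add: distrib_left)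
  qed
  have "Sum_any ?t = Sum_any (\<lambda>m. ?t (2 * m)) + Sum_any (\<lambda>m. ?t (2 * m + 1))"
    by (rule Sum_any_even_odd) (rule finite_support_bilateral)
  also have "\<dots> = mod7_sum even_weight 0 (Suc n) + mod7_sum even_weight 1 (Suc n)
      + (mod7_sum (\<lambda>m. - odd_weight m) 4 (Suc n) + mod7_sum (\<lambda>m. - odd_weight m) 5 (Suc n))"
    unfolding even odd mod7_sum_def by (simp only: Sum_any.distrib[OF mod7_sum_finite mod7_sum_finite])
  also have "\<dots> = outer_sum (Suc n) + inner_sum (Suc n)"
    using mod7_sum_scale[of "- 1" odd_weight] by (simp add: outer_sum_def inner_sum_def)
  finally show ?thesis .
qed

text \<open>With \<open>z = q^N\<close>, all terms are linear in the three sums at \<open>N\<close>, with coefficients that are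
  polynomials in \<open>q\<close> and \<open>z\<close>; the coefficients agree.\<close>

lemma bilateral_rec:
  fixes R :: "nat \<Rightarrow> int poly fract"
  defines "R \<equiv> \<lambda>N. outer_sum N + inner_sum N"
  shows "R (Suc (Suc (Suc N))) = (1 - q - q ^ 2) * R (Suc (Suc N))
     + (q ^ (2 * Suc (Suc N)) - q ^ 3 + q ^ 2 + q) * R (Suc N) + q ^ 3 * R N"
proof -
  define z where "z = q ^ N"
  have power: "q ^ (2 * Suc (Suc N)) = q ^ 4 * z ^ 2"
  proof -
    have "2 * Suc (Suc N) = 4 + N * 2" by simp
    then show ?thesis by (simp only: z_def power_add power_mult)
  qed
  show ?thesis
    unfolding power R_def outer_sum_Suc inner_sum_Suc middle_sum_Suc power_Suc z_def[symmetric] by algebra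
qed

lemma P_eq_outer_inner: "P n = outer_sum (Suc n) + inner_sum (Suc n)"
proof (induction n rule: less_induct)
  case (less n)
  consider "n = 0" | "n = 1" | "n = 2" | N where "n = Suc (Suc (Suc N))"
    by (metis One_nat_def numeral_2_eq_2 not0_implies_Suc)
  then show ?case
  proof cases
    case 1
    then show ?thesis by (simp add: P_0 outer_sum_Suc inner_sum_Suc middle_sum_Suc residue_sums_0)
  next
    case 2
    then show ?thesis by (simp add: P_1[simplified] outer_sum_Suc inner_sum_Suc middle_sum_Suc residue_sums_0)
  next
    case 3
    then show ?thesis
      by (simp add: P_2[simplified] numeral_2_eq_2 outer_sum_Suc inner_sum_Suc middle_sum_Suc residue_sums_0) (simp add: P_2[unfolded numeral_2_eq_2] eval_nat_numeral)
  next
    case 4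
    have "P n = (1 - q - q ^ 2) * P (Suc (Suc N))
            + (q ^ (2 * n) - q ^ 3 + q ^ 2 + q) * P (Suc N) + q ^ 3 * P N"
      using P_rec[of n] by (simp add: 4 numeral_3_eq_3 numeral_2_eq_2)
    moreover have "P (Suc (Suc N)) = outer_sum (Suc (Suc (Suc N))) + inner_sum (Suc (Suc (Suc N)))"
      "P (Suc N) = outer_sum (Suc (Suc N)) + inner_sum (Suc (Suc N))" "P N = outer_sum (Suc N) + inner_sum (Suc N)"
      by (rule less.IH, simp add: 4)+
    ultimately show ?thesis
      unfolding 4 bilateral_rec[of "Suc N"] by simp
  qed
qed

theorem mainTheorem10:
  shows "(\<forall>n. P n =
            Sum_any (\<lambda>j::int. (- 1) powi j * q powi (j * (7 * j + 3) div 2) *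
              gauss_poly (q ^ 2) (int n + 1) ((2 * int n + 7 * j + 5) div 4))) \<and>
         P 0 = 1 \<and> P 1 = 1 \<and> P 2 = q ^ 4 + 1 \<and>
         (\<forall>n\<ge>3. P n =
            (1 - q - q ^ 2) * P (n - 1)
            + (q ^ (2 * n) - q ^ 3 + q ^ 2 + q) * P (n - 2)
            + q ^ 3 * P (n - 3))"
  using P_eq_outer_inner bilateral_sum_eq P_0 P_1 P_2 P_rec by simp

end
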